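(* Let $f:[0,\infty)\to\mathcal{H}_{\mathrm r}$ and $g:[0,\infty)\to\mathcal{H}_{\mathrm u}$ be continuous, and let $(x,y)$ be a classical solution on $[0,\infty)$ of $$x'(t)=Ax(t)+By(t)+f(t),\qquad y'(t)=Cx(t)+Dy(t)+g(t),\qquad x(0)=x_0,\ y(0)=y_0 .$$ Assume that $(x,y)$ is of exponential order and that $Ax,\ Dy,\ f,\ g$ are also of exponential order, so that the Laplace transform may be applied term by term in the complexified spaces. Then, for all complex $\zeta$ with $\operatorname{Re}\zeta$ sufficiently large, $$\left[\zeta I-A-B(\zeta I-D)^{-1}C\right]\widehat x(\zeta)=x_0+\widehat f(\zeta)+B(\zeta I-D)^{-1}\{y_0+\widehat g(\zeta)\}.$$ Furthermore, for the kernel $K(t):=BS_D(t)C$, $$\widehat K(\zeta)=B(\zeta I-D)^{-1}C .$$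
   Context: $\mathcal{H}_{\mathrm r}$ and $\mathcal{H}_{\mathrm u}$ are separable real Hilbert spaces; whenever Laplace transforms are used, one passes to the canonical complexifications of the spaces and operators without changing notation. $A:D(A)\subset\mathcal{H}_{\mathrm r}\to\mathcal{H}_{\mathrm r}$ and $D:D(D)\subset\mathcal{H}_{\mathrm u}\to\mathcal{H}_{\mathrm u}$ generate strongly continuous semigroups $S_A(t)$ and $S_D(t)$. $B:\mathcal{H}_{\mathrm u}\to\mathcal{H}_{\mathrm r}$ and $C:\mathcal{H}_{\mathrm r}\to\mathcal{H}_{\mathrm u}$ are bounded linear operators. A classical solution is a pair $(x,y)$ that is continuous on $[0,\infty)$, continuously differentiable on $(0,\infty)$, with $x(t)\in D(A)$, $y(t)\in D(D)$ for $t>0$, satisfying the equations for $t>0$ and attaining the initial values. For a function $v$ of exponential order (that is, $\|v(t)\|\le c\,e^{\omega t}$ for some constants $c,\omega$), the Laplace transform is $\widehat v(\zeta):=\int_0^\infty e^{-\zeta t}v(t)\,dt$ for $\operatorname{Re}\zeta$ sufficiently large; for the operator-valued kernel $K$ it is understood strongly, i.e. $\widehat K(\zeta)v=\int_0^\infty e^{-\zeta t}K(t)v\,dt$ for each vector $v$. *)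

theory Defs
  imports "HOL-Analysis.Analysis"
begin

section \<open>Complexification\<close>

text \<open>
  The canonical complexification of a real Hilbert space \<open>'a\<close> is carried by \<open>'a \<times> 'a\<close>, the pair
  \<open>(u, v)\<close> standing for \<open>u + i v\<close>. The norm of the product type,
  \<open>norm (u, v) = sqrt ((norm u)\<^sup>2 + (norm v)\<^sup>2)\<close>, is the Hilbert norm of the complexification.
\<close>

type_synonym 'a cpx = "'a \<times> 'a"

definition cscale :: "complex \<Rightarrow> 'a::real_vector cpx \<Rightarrow> 'a cpx"  (infixr "*\<^sub>C" 75)
  where "\<zeta> *\<^sub>C w =
    (Re \<zeta> *\<^sub>R fst w - Im \<zeta> *\<^sub>R snd w, Re \<zeta> *\<^sub>R snd w + Im \<zeta> *\<^sub>R fst w)"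

definition cpx :: "'a::real_vector \<Rightarrow> 'a cpx"
  where "cpx v = (v, 0)"

definition cpx_op :: "('a \<Rightarrow> 'b) \<Rightarrow> 'a cpx \<Rightarrow> 'b cpx"
  where "cpx_op T = map_prod T T"

definition cpx_dom :: "'a set \<Rightarrow> 'a cpx set"
  where "cpx_dom X = X \<times> X"

lemma cscale_cscale: "a *\<^sub>C b *\<^sub>C w = (a * b) *\<^sub>C w"
  by (simp add: cscale_def algebra_simps)

lemma cscale_of_real: "complex_of_real r *\<^sub>C w = r *\<^sub>R w"
  by (simp add: cscale_def scaleR_prod_def)

lemma norm_cscale: "norm (\<zeta> *\<^sub>C w) = cmod \<zeta> * norm w"
  for w :: "'a::real_inner cpx"
proof -
  have "(norm (\<zeta> *\<^sub>C w))\<^sup>2 = (cmod \<zeta> * norm w)\<^sup>2"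
    unfolding power_mult_distrib cmod_power2 power2_norm_eq_inner[of "\<zeta> *\<^sub>C w"]
      power2_norm_eq_inner[of w]
    by (simp add: cscale_def inner_prod_def inner_diff_left inner_diff_right inner_add_left
        inner_add_right inner_commute power2_eq_square algebra_simps)
  then show ?thesis
    by (simp add: power2_eq_iff_nonneg)
qed

section \<open>Strongly continuous semigroups, generators and resolvents\<close>

definition C0_semigroup :: "(real \<Rightarrow> 'a::real_normed_vector \<Rightarrow> 'a) \<Rightarrow> bool"
  where "C0_semigroup S \<longleftrightarrow>
    (\<forall>t\<ge>0. bounded_linear (S t)) \<and>
    S 0 = id \<and>
    (\<forall>s\<ge>0. \<forall>t\<ge>0. S (s + t) = S s \<circ> S t) \<and>
    (\<forall>v. continuous_on {0..} (\<lambda>t. S t v))"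

text \<open>
  An unbounded operator is a domain together with a total function whose values outside the domain
  are irrelevant. Being the generator fixes the domain and the values on it.
\<close>

definition generates ::
    "'a::real_normed_vector set \<Rightarrow> ('a \<Rightarrow> 'a) \<Rightarrow> (real \<Rightarrow> 'a \<Rightarrow> 'a) \<Rightarrow> bool"
  where "generates domT T S \<longleftrightarrow>
    C0_semigroup S \<and>
    domT = {v. \<exists>w. ((\<lambda>h. (S h v - v) /\<^sub>R h) \<longlongrightarrow> w) (at_right 0)} \<and>
    (\<forall>v\<in>domT. ((\<lambda>h. (S h v - v) /\<^sub>R h) \<longlongrightarrow> T v) (at_right 0))"

definition resolvent ::
    "'a::real_normed_vector cpx set \<Rightarrow> ('a cpx \<Rightarrow> 'a cpx) \<Rightarrow> complex \<Rightarrow> 'a cpx \<Rightarrow> 'a cpx"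
  where "resolvent domT T \<zeta> = inv_into domT (\<lambda>w. \<zeta> *\<^sub>C w - T w)"

definition resolvent_set ::
    "'a::real_normed_vector cpx set \<Rightarrow> ('a cpx \<Rightarrow> 'a cpx) \<Rightarrow> complex set"
  where "resolvent_set domT T =
    {\<zeta>. bij_betw (\<lambda>w. \<zeta> *\<^sub>C w - T w) domT UNIV \<and> bounded_linear (resolvent domT T \<zeta>)}"

section \<open>Laplace transform\<close>

text \<open>
  The bound is required for \<open>t > 0\<close> only: along a classical solution \<open>x\<close> the function
  \<open>t \<mapsto> A (x t)\<close> need not be meaningful at \<open>t = 0\<close>. A single value can always be absorbed in the
  constant \<open>c\<close>, so for functions on \<open>[0, \<infinity>)\<close> nothing changes.
\<close>

definition exp_order :: "(real \<Rightarrow> 'a::real_normed_vector) \<Rightarrow> bool"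
  where "exp_order v \<longleftrightarrow> (\<exists>c \<omega>. \<forall>t>0. norm (v t) \<le> c * exp (\<omega> * t))"

definition laplace_exists ::
    "(real \<Rightarrow> 'a::{banach, second_countable_topology} cpx) \<Rightarrow> complex \<Rightarrow> bool"
  where "laplace_exists v \<zeta> \<longleftrightarrow>
    set_integrable lborel {0..} (\<lambda>t. exp (- (\<zeta> * complex_of_real t)) *\<^sub>C v t)"

definition laplace ::
    "(real \<Rightarrow> 'a::{banach, second_countable_topology} cpx) \<Rightarrow> complex \<Rightarrow> 'a cpx"
  where "laplace v \<zeta> = (LINT t:{0..}|lborel. exp (- (\<zeta> * complex_of_real t)) *\<^sub>C v t)"

section \<open>Classical solutions of the coupled system\<close>

definition classical_solution ::
    "'r::real_normed_vector set \<Rightarrow> ('r \<Rightarrow> 'r) \<Rightarrow> ('u::real_normed_vector \<Rightarrow> 'r) \<Rightarrow>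
     ('r \<Rightarrow> 'u) \<Rightarrow> 'u set \<Rightarrow> ('u \<Rightarrow> 'u) \<Rightarrow> (real \<Rightarrow> 'r) \<Rightarrow> (real \<Rightarrow> 'u) \<Rightarrow>
     'r \<Rightarrow> 'u \<Rightarrow> (real \<Rightarrow> 'r) \<Rightarrow> (real \<Rightarrow> 'u) \<Rightarrow> bool"
  where "classical_solution domA A B C domD D f g x\<^sub>0 y\<^sub>0 x y \<longleftrightarrow>
    continuous_on {0..} x \<and> continuous_on {0..} y \<and>
    x C1_differentiable_on {0<..} \<and> y C1_differentiable_on {0<..} \<and>
    (\<forall>t>0. x t \<in> domA \<and> y t \<in> domD \<and>
      (x has_vector_derivative (A (x t) + B (y t) + f t)) (at t) \<and>
      (y has_vector_derivative (C (x t) + D (y t) + g t)) (at t)) \<and>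
    x 0 = x\<^sub>0 \<and> y 0 = y\<^sub>0"

end

theory Submission
  imports Defs
begin

text \<open>
  Twisting a strongly continuous semigroup \<open>S\<close> with generator \<open>T\<close> by \<open>exp (- \<zeta> t)\<close> gives a
  semigroup with generator \<open>T - \<zeta>\<close> on the same domain, exponentially stable when \<open>Re \<zeta>\<close> is large.
  For a stable semigroup the integral of the orbits inverts the negative of the generator, so the
  resolvent of \<open>T\<close> is the Laplace transform of \<open>S\<close>; this gives the formula for the kernel.
  A generator commutes with Bochner integrals, by dominated convergence of the difference quotients,
  and integration by parts on the half-line then turns both evolution equations into algebraic
  ones, from which the transform of \<open>y\<close> is eliminated by the resolvent of \<open>D\<close>.
\<close>

section \<open>The uniform boundedness principle\<close>

text \<open>Baire's theorem: the closed sets \<open>F n\<close> on which all operators are bounded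
  by \<open>n\<close> cover the space, so one of them contains a ball. Linearity moves the bound
  from that ball to the origin.\<close>

lemma uniform_boundedness:
  fixes S :: "'i \<Rightarrow> 'a::banach \<Rightarrow> 'b::real_normed_vector"
  assumes lin: "\<And>i. i \<in> I \<Longrightarrow> bounded_linear (S i)"
    and bdd: "\<And>v. bounded ((\<lambda>i. S i v) ` I)"
  obtains M where "0 < M" "\<And>i v. i \<in> I \<Longrightarrow> norm (S i v) \<le> M * norm v"
proof -
  define F where "F n = {v. \<forall>i\<in>I. norm (S i v) \<le> real n}" for n :: nat
  have "closed (F n)" for n
  proof -
    have "F n = (\<Inter>i\<in>I. {v. norm (S i v) \<le> real n})"
      by (auto simp: F_def)
    also have "closed \<dots>"
      using lin by (intro closed_INT ballI closed_Collect_le continuous_intros)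
        (auto intro: bounded_linear.continuous_on)
    finally show ?thesis .
  qed
  moreover have "\<Union>(range F) = UNIV"
  proof -
    have "v \<in> \<Union>(range F)" for v
    proof -
      obtain b where b: "\<forall>i\<in>I. norm (S i v) \<le> b"
        using bdd[of v] by (auto simp: bounded_iff)
      obtain n :: nat where "b \<le> real n"
        using real_arch_simple by blast
      with b have "v \<in> F n" by (auto simp: F_def intro: order_trans)
      then show ?thesis by blast
    qed
    then show ?thesis by blast
  qed
  ultimately obtain n where "interior (F n) \<noteq> {}"
  proof -
    assume closed: "\<And>n. closed (F n)" and Un: "\<Union>(range F) = UNIV"
    have "\<not> (\<forall>n. interior (F n) = {})"
    proof
      assume "\<forall>n. interior (F n) = {}"
      then have "interior (\<Union>(range F)) = {}"
        using Met_TC.metric_Baire_category_alt[of "range F"] closed complete_UNIV by fastforce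
      with Un show False by simp
    qed
    then show thesis using that by blast
  qed
  then obtain z e where e: "0 < e" "cball z e \<subseteq> F n"
    by (meson ex_in_conv mem_interior_cball)
  \<comment> \<open>The factor 2 comes from writing a small vector as a difference of two points of
    the ball; adding 1 keeps \<open>M\<close> positive when \<open>n\<close> is 0.\<close>
  define M where "M = 2 * real n / e + 1"
  have "0 < M" using e by (simp add: M_def add_nonneg_pos)
  moreover have "norm (S i v) \<le> M * norm v" if i: "i \<in> I" for i v
  proof (cases "v = 0")
    case True
    then show ?thesis using linear_simps(3)[OF lin[OF i]] by simp
  next
    case False
    \<comment> \<open>Scaling \<open>v\<close> to length \<open>e\<close> keeps
      \<open>z + c *\<^sub>R v\<close> in the closed ball.\<close>
    define c where "c = e / norm v"
    have c: "0 < c" using e False by (simp add: c_def)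
    have "z + c *\<^sub>R v \<in> cball z e" "z \<in> cball z e"
      using e False by (auto simp: dist_norm c_def)
    then have "norm (S i (z + c *\<^sub>R v)) \<le> n" "norm (S i z) \<le> n"
      using e i by (blast dest!: subsetD[OF e(2), unfolded F_def])+
    moreover have "c *\<^sub>R S i v = S i (z + c *\<^sub>R v) - S i z"
      by (simp add: linear_simps[OF lin[OF i]])
    ultimately have "norm (c *\<^sub>R S i v) \<le> 2 * n"
      using norm_triangle_ineq4[of "S i (z + c *\<^sub>R v)" "S i z"] by simp
    then have "norm (S i v) \<le> 2 * n / e * norm v"
      using c e False by (simp add: c_def field_simps)
    then show ?thesis by (simp add: M_def distrib_right add_increasing2)
  qed
  ultimately show thesis using that by blast
qed

subsection \<open>Strongly continuous semigroups\<close>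

lemma C0_semigroupD:
  assumes "C0_semigroup S"
  shows "0 \<le> t \<Longrightarrow> bounded_linear (S t)" "S 0 v = v"
    "0 \<le> s \<Longrightarrow> 0 \<le> t \<Longrightarrow> S (s + t) v = S s (S t v)" "continuous_on {0..} (\<lambda>t. S t v)"
  using assms by (auto simp: C0_semigroup_def)

text \<open>Each orbit over [0, 1] is a continuous image of a compact set, hence bounded; uniform
  boundedness makes the bound independent of the vector.\<close>

lemma C0_semigroup_bounded_Icc:
  fixes S :: "real \<Rightarrow> 'a::banach \<Rightarrow> 'a"
  assumes S: "C0_semigroup S"
  obtains M where "0 < M" "\<And>t v. 0 \<le> t \<Longrightarrow> t \<le> 1 \<Longrightarrow> norm (S t v) \<le> M * norm v"
proof -
  have bdd: "bounded ((\<lambda>t. S t v) ` {0..1})" for v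
    by (intro compact_imp_bounded compact_continuous_image
        continuous_on_subset[OF C0_semigroupD(4)[OF S]]) auto
  have lin: "bounded_linear (S t)" if "t \<in> {0..1}" for t
    using C0_semigroupD(1)[OF S] that by simp
  show thesis
    using uniform_boundedness[of "{0..1}" S, OF lin bdd] that by (metis atLeastAtMost_iff)
qed

text \<open>Each of the n unit steps in t = n + r costs a factor \<open>M\<close>, the remainder r
  one more, and M to the power n is exp (n ln M).\<close>

lemma C0_semigroup_exp_bound:
  fixes S :: "real \<Rightarrow> 'a::banach \<Rightarrow> 'a"
  assumes S: "C0_semigroup S"
  obtains M a where "0 < M" "0 \<le> a"
    "\<And>t v. 0 \<le> t \<Longrightarrow> norm (S t v) \<le> M * exp (a * t) * norm v"
proof -
  obtain M' where M': "0 < M'" "\<And>t v. 0 \<le> t \<Longrightarrow> t \<le> 1 \<Longrightarrow> norm (S t v) \<le> M' * norm v"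
    using C0_semigroup_bounded_Icc[OF S] by blast
  \<comment> \<open>With \<open>M\<close> at least 1, \<open>ln M\<close> is nonnegative, so it can
    serve as the growth rate and n may be replaced by the larger t in the exponent.\<close>
  define M where "M = max 1 M'"
  have M: "1 \<le> M" "\<And>t v. 0 \<le> t \<Longrightarrow> t \<le> 1 \<Longrightarrow> norm (S t v) \<le> M * norm v"
    using M'(2) by (auto simp: M_def intro: order_trans[OF M'(2) mult_right_mono])
  have step: "norm (S (real n + r) v) \<le> M ^ n * (M * norm v)" if "0 \<le> r" "r \<le> 1" for n r v
  proof (induction n)
    case 0
    then show ?case using M(2) that by simp
  next
    case (Suc n)
    have "S (real (Suc n) + r) v = S 1 (S (real n + r) v)"
      using C0_semigroupD(3)[OF S, of 1 "real n + r" v] that by (simp add: add.assoc)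
    then have "norm (S (real (Suc n) + r) v) \<le> M * norm (S (real n + r) v)"
      using M(2)[of 1] by simp
    also have "\<dots> \<le> M * (M ^ n * (M * norm v))"
      using Suc M(1) by (intro mult_left_mono) auto
    finally show ?case by (simp add: mult.assoc)
  qed
  have "norm (S t v) \<le> M * exp (ln M * t) * norm v" if t: "0 \<le> t" for t v
  proof -
    define n where "n = nat \<lfloor>t\<rfloor>"
    have n: "real n \<le> t" "t - real n \<le> 1" using t by (auto simp: n_def) linarith
    have "norm (S t v) \<le> M ^ n * (M * norm v)"
      using step[of "t - real n" n v] n by simp
    also have "M ^ n = exp (ln M * real n)"
      using M(1) by (simp add: exp_of_nat2_mult)
    also have "exp (ln M * real n) * (M * norm v) \<le> exp (ln M * t) * (M * norm v)"
      using M(1) n by (intro mult_right_mono) (auto intro: mult_left_mono)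
    finally show ?thesis by (simp add: mult_ac)
  qed
  then show thesis using that[of M "ln M"] M(1) by simp
qed

section \<open>Generators: linearity, increments and integrals\<close>

lemma generatesD:
  assumes "generates domT T S"
  shows "C0_semigroup S"
    "v \<in> domT \<Longrightarrow> ((\<lambda>h. (S h v - v) /\<^sub>R h) \<longlongrightarrow> T v) (at_right 0)"
    "((\<lambda>h. (S h v - v) /\<^sub>R h) \<longlongrightarrow> w) (at_right 0) \<Longrightarrow> v \<in> domT"
  using assms unfolding generates_def by blast+

text \<open>The tool for computing with generators: a limit of difference quotients yields
  membership in the domain and, by uniqueness of limits, the value.\<close>

lemma generates_eqI:
  assumes "generates domT T S" "((\<lambda>h. (S h v - v) /\<^sub>R h) \<longlongrightarrow> w) (at_right 0)"
  shows "v \<in> domT" "T v = w"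
proof -
  show "v \<in> domT" using generatesD(3)[OF assms] .
  then show "T v = w"
    using tendsto_unique[OF trivial_limit_at_right_real generatesD(2)[OF assms(1)] assms(2)] by blast
qed

lemma generates_linear:
  assumes T: "generates domT T S"
  shows "v \<in> domT \<Longrightarrow> w \<in> domT \<Longrightarrow> v + w \<in> domT \<and> T (v + w) = T v + T w"
    and "v \<in> domT \<Longrightarrow> c *\<^sub>R v \<in> domT \<and> T (c *\<^sub>R v) = c *\<^sub>R T v"
    and "0 \<in> domT \<and> T 0 = 0"
proof -
  note lin = C0_semigroupD(1)[OF generatesD(1)[OF T]]
  \<comment> \<open>\<open>S h\<close> is known to be linear for nonnegative h only, so the
    quotients can be rearranged only eventually.\<close>
  have ev: "eventually (\<lambda>h. 0 < h) (at_right (0::real))"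
    by (simp add: eventually_at_right_less)
  show "v + w \<in> domT \<and> T (v + w) = T v + T w" if "v \<in> domT" "w \<in> domT"
  proof -
    have "((\<lambda>h. (S h (v + w) - (v + w)) /\<^sub>R h) \<longlongrightarrow> T v + T w) (at_right 0)"
    proof (rule Lim_transform_eventually[OF tendsto_add[OF generatesD(2)[OF T that(1)]
            generatesD(2)[OF T that(2)]]])
      show "\<forall>\<^sub>F h in at_right 0. (S h v - v) /\<^sub>R h + (S h w - w) /\<^sub>R h
          = (S h (v + w) - (v + w)) /\<^sub>R h"
        using ev by eventually_elim (simp add: linear_simps[OF lin] algebra_simps)
    qed
    then show ?thesis using generates_eqI[OF T] by blast
  qed
  show scale: "c *\<^sub>R v \<in> domT \<and> T (c *\<^sub>R v) = c *\<^sub>R T v" if "v \<in> domT" for v c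
  proof -
    have "((\<lambda>h. (S h (c *\<^sub>R v) - c *\<^sub>R v) /\<^sub>R h) \<longlongrightarrow> c *\<^sub>R T v) (at_right 0)"
    proof (rule Lim_transform_eventually[OF tendsto_scaleR[OF tendsto_const
            generatesD(2)[OF T that]]])
      show "\<forall>\<^sub>F h in at_right 0. c *\<^sub>R ((S h v - v) /\<^sub>R h) = (S h (c *\<^sub>R v) - c *\<^sub>R v) /\<^sub>R h"
        using ev by eventually_elim (simp add: linear_simps[OF lin] algebra_simps)
    qed
    then show ?thesis using generates_eqI[OF T] by blast
  qed
  have "0 \<in> domT"
    by (rule generatesD(3)[OF T, of _ 0], rule Lim_transform_eventually[OF tendsto_const],
      use ev in eventually_elim) (simp add: linear_simps[OF lin])
  then show "0 \<in> domT \<and> T 0 = 0"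
    using scale[of 0 0] by simp
qed

text \<open>Telescoping over \<open>n\<close> equal subintervals of \<open>[0, h]\<close> and \<open>n \<rightarrow> \<infinity>\<close> bounds the increment by
  the generator without differentiating the orbit or integrating along it.\<close>

lemma generator_increment_bound:
  assumes T: "generates domT T S" and v: "v \<in> domT" and h: "0 < h" and M: "0 \<le> M"
    and bound: "\<And>t w. 0 \<le> t \<Longrightarrow> t \<le> h \<Longrightarrow> norm (S t w) \<le> M * norm w"
  shows "norm (S h v - v) \<le> h * (M * norm (T v))"
proof -
  note S = generatesD(1)[OF T]
  \<comment> \<open>Cut [0, h] into n + 1 pieces of length d. The increment over the k-th piece is
    \<open>S (k * d)\<close> applied to the first one, and \<open>bound\<close> controls all these
    operators at once.\<close>
  have "norm (S h v - v) \<le> h * (M * norm ((S (h / Suc n) v - v) /\<^sub>R (h / Suc n)))" for n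
  proof -
    define d where "d = h / Suc n"
    have d: "0 < d" "Suc n * d = h" using h by (auto simp: d_def)
    have "norm (S (real k * d) v - v) \<le> real k * (M * norm (S d v - v))" if "k \<le> Suc n" for k
      using that
    proof (induction k)
      case 0
      then show ?case by (simp add: C0_semigroupD(2)[OF S])
    next
      case (Suc k)
      have kd: "real k * d \<le> h"
        using d Suc(2) mult_right_mono[of "real k" "real (Suc n)" d] by simp
      have "S (real (Suc k) * d) v - v = S (real k * d) (S d v - v) + (S (real k * d) v - v)"
        using C0_semigroupD(3)[OF S, of "real k * d" d v] d
          linear_simps(2)[OF C0_semigroupD(1)[OF S], of "real k * d" "S d v" v]
        by (simp add: algebra_simps)
      also have "norm \<dots> \<le> M * norm (S d v - v) + real k * (M * norm (S d v - v))"
        using Suc kd d by (intro norm_triangle_mono bound) auto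
      finally show ?case by (simp add: algebra_simps)
    qed
    from this[of "Suc n"] have "norm (S h v - v) \<le> Suc n * (M * norm (S d v - v))"
      using d by simp
    also have "\<dots> = h * (M * norm ((S d v - v) /\<^sub>R d))"
      using d(1) by (simp flip: d(2))
    finally show ?thesis by (simp add: d_def)
  qed
  \<comment> \<open>The step lengths tend to 0 from the right, so the quotients on the right-hand
    side tend to \<open>T v\<close>.\<close>
  moreover have "filterlim (\<lambda>n. h / real (Suc n)) (at_right 0) sequentially"
    using h LIMSEQ_Suc[OF lim_const_over_n[of h]] by (auto simp: filterlim_at)
  then have "(\<lambda>n. h * (M * norm ((S (h / Suc n) v - v) /\<^sub>R (h / Suc n)))) \<longlonglongrightarrow> h * (M * norm (T v))"
    by (intro tendsto_intros filterlim_compose[OF generatesD(2)[OF T v]])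
  ultimately show ?thesis
    by (intro LIMSEQ_le_const) auto
qed

text \<open>The instance of Hille's theorem on closed operators and integrals that is needed here.
  The increment bound supplies the integrable majorant.\<close>

lemma generator_integral:
  fixes S :: "real \<Rightarrow> 'a::{banach, second_countable_topology} \<Rightarrow> 'a"
  assumes T: "generates domT T S" and u: "integrable N u" "integrable N (\<lambda>t. T (u t))"
    and dom: "\<And>t. u t \<in> domT"
  shows "(LINT t|N. u t) \<in> domT" "T (LINT t|N. u t) = (LINT t|N. T (u t))"
proof -
  note S = generatesD(1)[OF T]
  note lin = C0_semigroupD(1)[OF S]
  obtain M where M: "0 < M" "\<And>t v. 0 \<le> t \<Longrightarrow> t \<le> 1 \<Longrightarrow> norm (S t v) \<le> M * norm v"
    using C0_semigroup_bounded_Icc[OF S] by blast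
  let ?U = "LINT t|N. u t"
  have "((\<lambda>h. (S h ?U - ?U) /\<^sub>R h) \<longlongrightarrow> (LINT t|N. T (u t))) (at_right 0)"
  \<comment> \<open>Dominated convergence works along sequences; taking them in (0, 1) lets one
    constant \<open>M\<close> bound all the operators \<open>S (X n)\<close>.\<close>
  proof (rule tendsto_at_right_sequentially[of 0 1])
    fix X :: "nat \<Rightarrow> real"
    assume X: "\<And>n. 0 < X n" "\<And>n. X n < 1" "X \<longlonglongrightarrow> 0"
    have int: "integrable N (\<lambda>t. S (X n) (u t))" for n
      using lin[of "X n"] X(1)[of n] u(1) by (intro integrable_bounded_linear[of "S (X n)"]) auto
    have "(\<lambda>n. LINT t|N. (S (X n) (u t) - u t) /\<^sub>R X n) \<longlonglongrightarrow> (LINT t|N. T (u t))"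
    proof (rule integral_dominated_convergence[where w = "\<lambda>t. M * norm (T (u t))"])
      show "(\<lambda>t. T (u t)) \<in> borel_measurable N" "integrable N (\<lambda>t. M * norm (T (u t)))"
        using u(2) by auto
      show "(\<lambda>t. (S (X n) (u t) - u t) /\<^sub>R X n) \<in> borel_measurable N" for n
        using int[of n] u(1) by auto
      have "filterlim X (at_right 0) sequentially"
        using X by (auto simp: filterlim_at intro!: always_eventually less_imp_neq[symmetric])
      then show "AE t in N. (\<lambda>n. (S (X n) (u t) - u t) /\<^sub>R X n) \<longlonglongrightarrow> T (u t)"
        using filterlim_compose[OF generatesD(2)[OF T dom]] by auto
      show "AE t in N. norm ((S (X n) (u t) - u t) /\<^sub>R X n) \<le> M * norm (T (u t))" for n
      proof (rule AE_I2)
        fix t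
        have "norm (S (X n) (u t) - u t) \<le> X n * (M * norm (T (u t)))"
          using M X(1,2)[of n] by (intro generator_increment_bound[OF T dom]) auto
        then show "norm ((S (X n) (u t) - u t) /\<^sub>R X n) \<le> M * norm (T (u t))"
          using X(1)[of n] by (simp add: divide_simps mult_ac)
      qed
    qed
    moreover have "(LINT t|N. (S (X n) (u t) - u t) /\<^sub>R X n) = (S (X n) ?U - ?U) /\<^sub>R X n" for n
      using int[of n] u(1) integral_bounded_linear[OF lin[of "X n"] u(1)] X(1)[of n] by simp
    ultimately show "(\<lambda>n. (S (X n) ?U - ?U) /\<^sub>R X n) \<longlonglongrightarrow> (LINT t|N. T (u t))"
      by (simp only:)
  qed simp
  from generates_eqI[OF T this] show "?U \<in> domT" "T ?U = (LINT t|N. T (u t))" .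
qed

subsection \<open>Integration on the half-line\<close>

lemma exp_decay_tendsto:
  assumes "0 < (a::real)"
  shows "((\<lambda>t. exp (- (a * t))) \<longlongrightarrow> 0) at_top"
proof -
  have "filterlim (\<lambda>t. - (a * t)) at_bot at_top"
    using assms by (auto simp: filterlim_uminus_at_top[symmetric]
        intro!: filterlim_tendsto_pos_mult_at_top[OF tendsto_const] filterlim_ident)
  then show ?thesis by (rule filterlim_compose[OF exp_at_bot])
qed

lemma set_integrable_exp_decay:
  assumes "0 < (a::real)"
  shows "set_integrable lborel {0..} (\<lambda>t. exp (- (a * t)))"
proof -
  have D: "((\<lambda>t. - exp (- (a * t)) / a) has_real_derivative exp (- (a * t))) (at t)" for t
    using assms by (auto intro!: derivative_eq_intros)
  have lim: "((\<lambda>t. - exp (- (a * t)) / a) \<longlongrightarrow> - 0 / a) at_top"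
    using assms by (intro tendsto_intros exp_decay_tendsto) auto
  have "(\<integral>\<^sup>+t. ennreal (exp (- (a * t))) * indicator {0..} t \<partial>lborel) = ennreal (- 0 / a - - exp (- (a * 0)) / a)"
    by (rule nn_integral_FTC_atLeast[OF _ D _ lim]) auto
  then have "(\<integral>\<^sup>+t. ennreal (norm (indicator {0..} t *\<^sub>R exp (- (a * t)))) \<partial>lborel) < \<infinity>"
    by (simp add: ennreal_mult'' ennreal_indicator mult.commute)
  then show ?thesis
    unfolding set_integrable_def by (intro integrableI_bounded) auto
qed

text \<open>The endpoint is a null set. This permits hypotheses for positive times only, as needed
  for \<open>A (x t)\<close>, which may be meaningless at 0.\<close>

lemma set_Ici_Ioi:
  fixes v :: "real \<Rightarrow> 'a::{banach, second_countable_topology}"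
  shows "set_integrable lborel {a..} v \<longleftrightarrow> set_integrable lborel {a<..} v"
    and "(LINT t:{a..}|lborel. v t) = (LINT t:{a<..}|lborel. v t)"
  by (rule set_integrable_discrete_difference[where X = "{a}"]; auto)
    (rule set_integral_discrete_difference[where X = "{a}"]; auto)

text \<open>Continuity on the open half-line gives measurability, the exponential an integrable
  majorant. Serves both the orbits of a stable semigroup and the Laplace integrands.\<close>

lemma set_integrable_exp_bound:
  fixes v :: "real \<Rightarrow> 'a::{banach, second_countable_topology}"
  assumes "continuous_on {0<..} v" "0 < a" "\<And>t. 0 < t \<Longrightarrow> norm (v t) \<le> c * exp (- (a * t))"
  shows "set_integrable lborel {0..} v"
  unfolding set_Ici_Ioi
proof (rule set_integrable_bound)
  show "set_integrable lborel {0<..} (\<lambda>t. c * exp (- (a * t)))"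
    using set_integrable_exp_decay[OF assms(2)] unfolding set_Ici_Ioi by simp
  show "set_borel_measurable lborel {0<..} v"
    using borel_measurable_continuous_on_indicator[OF _ assms(1)]
    by (simp add: set_borel_measurable_def)
  show "AE t in lborel. t \<in> {0<..} \<longrightarrow> norm (v t) \<le> norm (c * exp (- (a * t)))"
    using assms(3) by (intro AE_I2) (auto intro: order_trans[OF _ abs_ge_self])
qed

text \<open>The fundamental theorem of calculus for improper integrals is available for Euclidean spaces
  only; testing against the vectors of the Hilbert space reduces to the scalar case.\<close>

lemma integral_derivative_Ici:
  fixes F :: "real \<Rightarrow> 'a::{real_inner, banach, second_countable_topology}"
  assumes cont: "continuous_on {0..} F" "continuous_on {0<..} F'"
    and deriv: "\<And>t. 0 < t \<Longrightarrow> (F has_vector_derivative F' t) (at t)"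
    and int: "set_integrable lborel {0..} F'" and lim: "(F \<longlongrightarrow> 0) at_top"
  shows "(LINT t:{0..}|lborel. F' t) = - F 0"
proof -
  have "w \<bullet> (LINT t:{0..}|lborel. F' t) = w \<bullet> (- F 0)" for w
  proof -
    have int': "set_integrable lborel {0<..} F'"
      using int by (simp add: set_Ici_Ioi)
    have "(LBINT t=ereal 0..\<infinity>. w \<bullet> F' t) = 0 - w \<bullet> F 0"
    proof (rule interval_integral_FTC_integrable[where F = "\<lambda>t. w \<bullet> F t"])
      show "((\<lambda>t. w \<bullet> F t) has_vector_derivative w \<bullet> F' t) (at t)" if "ereal 0 < ereal t" for t
        using bounded_linear.has_vector_derivative[OF bounded_linear_inner_right deriv] that by simp
      show "isCont (\<lambda>t. w \<bullet> F' t) t" if "ereal 0 < ereal t" for t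
        using cont(2) that by (intro continuous_intros) (simp add: continuous_on_eq_continuous_at)
      show "set_integrable lborel (einterval (ereal 0) \<infinity>) (\<lambda>t. w \<bullet> F' t)"
        using integrable_inner_right[of w lborel "\<lambda>t. indicator {0<..} t *\<^sub>R F' t"] int'
        by (simp add: set_integrable_def)
      \<comment> \<open>The derivative is given for positive times only; the boundary term at 0
        comes from one-sided continuity.\<close>
      have "(F \<longlongrightarrow> F 0) (at_right 0)"
        using cont(1) by (auto simp: continuous_on_def at_within_Ici_at_right dest: bspec[of _ _ 0])
      then show "(((\<lambda>t. w \<bullet> F t) \<circ> real_of_ereal) \<longlongrightarrow> w \<bullet> F 0) (at_right (ereal 0))"
        unfolding ereal_tendsto_simps by (intro tendsto_intros)
      have "((\<lambda>t. w \<bullet> F t) \<longlongrightarrow> w \<bullet> 0) at_top"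
        by (intro tendsto_intros lim)
      then show "(((\<lambda>t. w \<bullet> F t) \<circ> real_of_ereal) \<longlongrightarrow> 0) (at_left \<infinity>)"
        unfolding ereal_tendsto_simps by simp
    qed simp
    moreover have "(LBINT t=ereal 0..\<infinity>. w \<bullet> F' t) = w \<bullet> (LINT t:{0<..}|lborel. F' t)"
      using integral_inner_right[of w lborel "\<lambda>t. indicator {0<..} t *\<^sub>R F' t"] int'
      by (simp add: interval_integral_to_infinity_eq set_integrable_def set_lebesgue_integral_def)
    ultimately show ?thesis by (simp add: set_Ici_Ioi)
  qed
  then show ?thesis using vector_eq_ldot by blast
qed

text \<open>Used to differentiate an orbit integral at 0. The half-open interval is the complement
  of \<open>{h..}\<close> in \<open>{0..}\<close>, which makes the later splitting disjoint.\<close>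

lemma average_tendsto:
  fixes u :: "real \<Rightarrow> 'a::{banach, second_countable_topology}"
  assumes cont: "continuous_on {0..} u" and int: "set_integrable lborel {0..} u"
  shows "((\<lambda>h. (LINT t:{0..<h}|lborel. u t) /\<^sub>R h) \<longlongrightarrow> u 0) (at_right 0)"
proof (rule tendstoI)
  fix e :: real
  assume "0 < e"
  \<comment> \<open>Halving \<open>e\<close> leaves room for a strict inequality, since integration
    only preserves weak ones.\<close>
  then obtain d where d: "0 < d" "\<And>t. 0 \<le> t \<Longrightarrow> t < d \<Longrightarrow> dist (u t) (u 0) < e / 2"
    using cont[unfolded continuous_on_iff, rule_format, of 0 "e / 2"] by (force simp: dist_real_def)
  have "dist ((LINT t:{0..<h}|lborel. u t) /\<^sub>R h) (u 0) < e" if h: "0 < h" "h < d" for h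
  proof -
    \<comment> \<open>Stated for an arbitrary type, because it is used for the vector
      \<open>u 0\<close> as well as for the number \<open>e / 2\<close>.\<close>
    have const: "set_integrable lborel {0..<h} (\<lambda>t. c)" "(LINT t:{0..<h}|lborel. c) = h *\<^sub>R c"
      for c :: "'b::{banach, second_countable_topology}"
      using h by (auto simp: set_integrable_def set_lebesgue_integral_def)
    have int_h: "set_integrable lborel {0..<h} u"
      by (rule set_integrable_subset[OF int]) auto
    have "norm ((LINT t:{0..<h}|lborel. u t) - h *\<^sub>R u 0) = norm (LINT t:{0..<h}|lborel. u t - u 0)"
      using set_integral_diff(2)[OF int_h const(1)] const(2)[of "u 0"] by simp
    also have "\<dots> \<le> (LINT t:{0..<h}|lborel. norm (u t - u 0))"
      by (intro set_integral_norm_bound set_integral_diff int_h const)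
    also have "\<dots> \<le> (LINT t:{0..<h}|lborel. e / 2)"
      using d(2) h
      by (intro set_integral_mono set_integrable_norm set_integral_diff int_h const)
        (auto simp: dist_norm intro: less_imp_le)
    also have "\<dots> = h * (e / 2)" by (simp add: const)
    finally have "norm (h *\<^sub>R ((LINT t:{0..<h}|lborel. u t) /\<^sub>R h - u 0)) \<le> h * (e / 2)"
      using h by (simp add: scaleR_diff_right)
    then have "norm ((LINT t:{0..<h}|lborel. u t) /\<^sub>R h - u 0) \<le> e / 2" using h by simp
    with \<open>0 < e\<close> show ?thesis by (simp add: dist_norm)
  qed
  with d(1) show "\<forall>\<^sub>F h in at_right 0. dist ((LINT t:{0..<h}|lborel. u t) /\<^sub>R h) (u 0) < e"
    by (auto simp: eventually_at_right_field)
qed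

subsection \<open>Exponentially stable semigroups\<close>

context
  fixes S :: "real \<Rightarrow> 'a::{banach, second_countable_topology} \<Rightarrow> 'a" and domG G M a
  assumes G: "generates domG G S" and a: "0 < (a::real)"
    and decay: "\<And>t v. 0 \<le> t \<Longrightarrow> norm (S t v) \<le> M * exp (- (a * t)) * norm v"
begin

lemma stable_semigroup_integrable: "set_integrable lborel {0..} (\<lambda>t. S t v)"
proof (rule set_integrable_exp_bound[OF _ a])
  show "continuous_on {0<..} (\<lambda>t. S t v)"
    by (rule continuous_on_subset[OF C0_semigroupD(4)[OF generatesD(1)[OF G]]]) auto
  show "norm (S t v) \<le> M * norm v * exp (- (a * t))" if "0 < t" for t
    using decay[of t v] that by (simp add: mult_ac)
qed

text \<open>The orbit integral will be the resolvent, and membership in \<open>resolvent_set\<close>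
  demands that it be bounded; the integral of the decay bound is the operator bound.\<close>

lemma stable_semigroup_bounded_linear: "bounded_linear (\<lambda>v. LINT t:{0..}|lborel. S t v)"
proof (rule bounded_linear_intro)
  note lin = C0_semigroupD(1)[OF generatesD(1)[OF G]]
  fix v w c
  have "(LINT t:{0..}|lborel. S t (v + w)) = (LINT t:{0..}|lborel. S t v + S t w)"
    by (rule set_lebesgue_integral_cong) (auto simp: linear_simps[OF lin])
  then show "(LINT t:{0..}|lborel. S t (v + w))
      = (LINT t:{0..}|lborel. S t v) + (LINT t:{0..}|lborel. S t w)"
    by (simp add: set_integral_add stable_semigroup_integrable)
  have "(LINT t:{0..}|lborel. S t (c *\<^sub>R v)) = (LINT t:{0..}|lborel. c *\<^sub>R S t v)"
    by (rule set_lebesgue_integral_cong) (auto simp: linear_simps[OF lin])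
  then show "(LINT t:{0..}|lborel. S t (c *\<^sub>R v)) = c *\<^sub>R (LINT t:{0..}|lborel. S t v)"
    by simp
  have "norm (LINT t:{0..}|lborel. S t v) \<le> (LINT t:{0..}|lborel. norm (S t v))"
    by (rule set_integral_norm_bound[OF stable_semigroup_integrable])
  also have "\<dots> \<le> (LINT t:{0..}|lborel. norm v * (M * exp (- (a * t))))"
    using decay[of _ v] set_integrable_exp_decay[OF a]
    by (intro set_integral_mono set_integrable_norm stable_semigroup_integrable) (auto simp: mult_ac)
  finally show "norm (LINT t:{0..}|lborel. S t v)
      \<le> norm v * (LINT t:{0..}|lborel. M * exp (- (a * t)))"
    by simp
qed

text \<open>Applying \<open>S h\<close> moves the lower limit of the orbit integral to
  \<open>h\<close>. The difference quotient is thus minus the mean of the orbit over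
  \<open>{0..<h}\<close> and tends to \<open>- v\<close>.\<close>

lemma stable_generator_integral:
  "(LINT t:{0..}|lborel. S t v) \<in> domG" "G (LINT t:{0..}|lborel. S t v) = - v"
proof -
  note S = generatesD(1)[OF G]
  let ?R = "LINT t:{0..}|lborel. S t v"
  note int = stable_semigroup_integrable[of v]
  have shift: "S h ?R = (LINT t:{h..}|lborel. S t v)" if h: "0 < h" for h
  proof -
    have "S h ?R = (LINT t|lborel. S h (indicator {0..} t *\<^sub>R S t v))"
      using integral_bounded_linear[OF C0_semigroupD(1)[OF S] int[unfolded set_integrable_def]] h
      by (simp add: set_lebesgue_integral_def)
    \<comment> \<open>The form \<open>h + 1 * t\<close> is that of an affine substitution with slope
      1; the indicator at \<open>t\<close> turns into that of \<open>{h..}\<close> at the shifted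
      time.\<close>
    also have "\<dots> = (LINT t|lborel. indicator {h..} (h + 1 * t) *\<^sub>R S (h + 1 * t) v)"
      using h C0_semigroupD(3)[OF S, of h] linear_simps(3,5)[OF C0_semigroupD(1)[OF S, of h]]
      by (intro Bochner_Integration.integral_cong) (auto simp: indicator_def)
    also have "\<dots> = (LINT t:{h..}|lborel. S t v)"
      using lborel_integral_real_affine[of 1 "\<lambda>t. indicator {h..} t *\<^sub>R S t v" h]
      by (simp add: set_lebesgue_integral_def)
    finally show ?thesis .
  qed
  have "((\<lambda>h. (LINT t:{0..<h}|lborel. S t v) /\<^sub>R h) \<longlongrightarrow> v) (at_right 0)"
    using average_tendsto[OF C0_semigroupD(4)[OF S] int] by (simp add: C0_semigroupD(2)[OF S])
  then have "((\<lambda>h. (S h ?R - ?R) /\<^sub>R h) \<longlongrightarrow> - v) (at_right 0)"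
  proof (rule Lim_transform_eventually[OF tendsto_minus])
    have "- ((LINT t:{0..<h}|lborel. S t v) /\<^sub>R h) = (S h ?R - ?R) /\<^sub>R h" if h: "0 < h" for h
    proof -
      have "?R = (LINT t:{0..<h} \<union> {h..}|lborel. S t v)"
        using h by (simp add: ivl_disj_un)
      also have "\<dots> = (LINT t:{0..<h}|lborel. S t v) + (LINT t:{h..}|lborel. S t v)"
        using h by (intro set_integral_Un set_integrable_subset[OF int]) auto
      finally show ?thesis using shift[OF h] by simp
    qed
    then show "\<forall>\<^sub>F h in at_right 0. - ((LINT t:{0..<h}|lborel. S t v) /\<^sub>R h) = (S h ?R - ?R) /\<^sub>R h"
      using eventually_at_right_less by (rule eventually_mono[rotated])
  qed
  from generates_eqI[OF G this] show "?R \<in> domG" "G ?R = - v" .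
qed

text \<open>By the increment bound a vector annihilated by the generator has a constant orbit, and a
  constant orbit that decays is zero.\<close>

lemma stable_generator_kernel:
  assumes v: "v \<in> domG" "G v = 0"
  shows "v = 0"
proof (rule ccontr)
  assume "v \<noteq> 0"
  note S = generatesD(1)[OF G]
  \<comment> \<open>The sign of \<open>M\<close> is not assumed; the decay bound at time 0 with a
    nonzero \<open>v\<close> forces it.\<close>
  have "norm v \<le> M * norm v"
    using decay[of 0 v] by (simp add: C0_semigroupD(2)[OF S])
  then have M: "0 \<le> M" using \<open>v \<noteq> 0\<close> by (simp add: mult_le_cancel_right1)
  have bound: "norm (S t w) \<le> M * norm w" if "0 \<le> t" for t w
  proof -
    have "M * exp (- (a * t)) * norm w \<le> M * 1 * norm w"
      using M a that by (intro mult_right_mono mult_left_mono) auto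
    with decay[OF that, of w] show ?thesis by simp
  qed
  have "S h v = v" if "0 < h" for h
    using generator_increment_bound[OF G v(1) that M bound] v(2) by simp
  then have "\<forall>\<^sub>F h in at_top. norm v \<le> M * exp (- (a * h)) * norm v"
    using decay[of _ v] by (intro eventually_mono[OF eventually_gt_at_top[of 0]]) (metis less_imp_le)
  moreover have "((\<lambda>h. M * exp (- (a * h)) * norm v) \<longlongrightarrow> M * 0 * norm v) at_top"
    by (intro tendsto_intros exp_decay_tendsto a)
  ultimately have "norm v \<le> M * 0 * norm v"
    by (intro tendsto_lowerbound) auto
  with \<open>v \<noteq> 0\<close> show False by simp
qed

end

subsection \<open>Complexified semigroups\<close>

lemma cscale_one: "1 *\<^sub>C w = w"
  by (simp add: cscale_def)

text \<open>Bilinearity over the reals yields limits, continuity and the product rule for complex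
  scaling, although the carrier is only a real vector space.\<close>

lemma bounded_bilinear_cscale:
  "bounded_bilinear (cscale :: complex \<Rightarrow> 'a::real_inner cpx \<Rightarrow> 'a cpx)"
proof
  show "\<exists>K. \<forall>a (b :: 'a cpx). norm (a *\<^sub>C b) \<le> norm a * norm b * K"
    by (intro exI[of _ 1]) (simp add: norm_cscale)
qed (auto simp: cscale_def algebra_simps prod_eq_iff)

lemmas bounded_linear_cscale = bounded_bilinear.bounded_linear_right[OF bounded_bilinear_cscale]

lemma bounded_linear_cpx: "bounded_linear (cpx :: 'a::real_normed_vector \<Rightarrow> 'a cpx)"
  unfolding cpx_def by (intro bounded_linear_Pair bounded_linear_ident bounded_linear_zero)

lemma norm_cpx: "norm (cpx v) = norm v"
  by (simp add: cpx_def)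

lemma bounded_linear_cpx_op:
  assumes "bounded_linear T"
  shows "bounded_linear (cpx_op T)"
proof -
  have "cpx_op T = (\<lambda>w. (T (fst w), T (snd w)))"
    by (auto simp: cpx_op_def)
  then show ?thesis
    by (simp add: bounded_linear_Pair bounded_linear_compose[OF assms]
        bounded_linear_fst bounded_linear_snd)
qed

lemma cpx_op_cscale:
  assumes "bounded_linear T"
  shows "cpx_op T (\<zeta> *\<^sub>C w) = \<zeta> *\<^sub>C cpx_op T w"
  by (simp add: cpx_op_def cscale_def linear_simps[OF assms] map_prod_def split: prod.split)

lemma cpx_op_cpx: "T 0 = 0 \<Longrightarrow> cpx_op T (cpx v) = cpx (T v)"
  by (simp add: cpx_op_def cpx_def)

text \<open>Complex scaling mixes the two components by real linear combinations, which a
  real-linear operator and its domain respect.\<close>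

lemma generates_cscale:
  assumes T: "generates domT T S" and w: "w \<in> cpx_dom domT"
  shows "\<zeta> *\<^sub>C w \<in> cpx_dom domT" "cpx_op T (\<zeta> *\<^sub>C w) = \<zeta> *\<^sub>C cpx_op T w"
proof -
  obtain p q where pq: "w = (p, q)" "p \<in> domT" "q \<in> domT"
    using w by (auto simp: cpx_dom_def)
  have comb: "b *\<^sub>R p + c *\<^sub>R q \<in> domT \<and> T (b *\<^sub>R p + c *\<^sub>R q) = b *\<^sub>R T p + c *\<^sub>R T q" for b c
    using generates_linear(1)[OF T] generates_linear(2)[OF T] pq by metis
  have 1: "Re \<zeta> *\<^sub>R p - Im \<zeta> *\<^sub>R q \<in> domT"
      "T (Re \<zeta> *\<^sub>R p - Im \<zeta> *\<^sub>R q) = Re \<zeta> *\<^sub>R T p - Im \<zeta> *\<^sub>R T q"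
    using comb[of "Re \<zeta>" "- Im \<zeta>"] by auto
  have 2: "Re \<zeta> *\<^sub>R q + Im \<zeta> *\<^sub>R p \<in> domT"
      "T (Re \<zeta> *\<^sub>R q + Im \<zeta> *\<^sub>R p) = Re \<zeta> *\<^sub>R T q + Im \<zeta> *\<^sub>R T p"
    using comb[of "Im \<zeta>" "Re \<zeta>"] by (auto simp: add.commute)
  show "\<zeta> *\<^sub>C w \<in> cpx_dom domT" "cpx_op T (\<zeta> *\<^sub>C w) = \<zeta> *\<^sub>C cpx_op T w"
    using 1 2 by (auto simp: cscale_def cpx_dom_def cpx_op_def pq)
qed

text \<open>The difference quotients act componentwise, and a limit in the product exists exactly
  when both component limits do.\<close>

lemma generates_cpx:
  assumes T: "generates domT T S"
  shows "generates (cpx_dom domT) (cpx_op T) (\<lambda>t. cpx_op (S t))"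
proof -
  note S = generatesD(1)[OF T]
  have quot: "(cpx_op (S h) (p, q) - (p, q)) /\<^sub>R h = ((S h p - p) /\<^sub>R h, (S h q - q) /\<^sub>R h)"
    for h p q by (simp add: cpx_op_def)
  have *: "((\<lambda>h. (cpx_op (S h) (p, q) - (p, q)) /\<^sub>R h) \<longlongrightarrow> w) (at_right 0) \<longleftrightarrow>
      ((\<lambda>h. (S h p - p) /\<^sub>R h) \<longlongrightarrow> fst w) (at_right 0) \<and>
      ((\<lambda>h. (S h q - q) /\<^sub>R h) \<longlongrightarrow> snd w) (at_right 0)" for p q w
  proof (intro iffI conjI)
    assume lim: "((\<lambda>h. (cpx_op (S h) (p, q) - (p, q)) /\<^sub>R h) \<longlongrightarrow> w) (at_right 0)"
    show "((\<lambda>h. (S h p - p) /\<^sub>R h) \<longlongrightarrow> fst w) (at_right 0)"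
      using tendsto_fst[OF lim] by (simp only: quot fst_conv)
    show "((\<lambda>h. (S h q - q) /\<^sub>R h) \<longlongrightarrow> snd w) (at_right 0)"
      using tendsto_snd[OF lim] by (simp only: quot snd_conv)
  next
    assume "((\<lambda>h. (S h p - p) /\<^sub>R h) \<longlongrightarrow> fst w) (at_right 0) \<and>
      ((\<lambda>h. (S h q - q) /\<^sub>R h) \<longlongrightarrow> snd w) (at_right 0)"
    then show "((\<lambda>h. (cpx_op (S h) (p, q) - (p, q)) /\<^sub>R h) \<longlongrightarrow> w) (at_right 0)"
      unfolding quot using tendsto_Pair by fastforce
  qed
  have mem: "p \<in> domT \<longleftrightarrow> (\<exists>w. ((\<lambda>h. (S h p - p) /\<^sub>R h) \<longlongrightarrow> w) (at_right 0))" for p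
    using generatesD(2,3)[OF T] by blast
  have "C0_semigroup (\<lambda>t. cpx_op (S t))"
    unfolding C0_semigroup_def
  proof (intro conjI allI impI)
    show "bounded_linear (cpx_op (S t))" if "0 \<le> t" for t
      by (rule bounded_linear_cpx_op[OF C0_semigroupD(1)[OF S that]])
    show "cpx_op (S 0) = id"
      by (auto simp: cpx_op_def C0_semigroupD(2)[OF S])
    show "cpx_op (S (s + t)) = cpx_op (S s) \<circ> cpx_op (S t)" if "0 \<le> s" "0 \<le> t" for s t
      by (auto simp: cpx_op_def C0_semigroupD(3)[OF S that])
    show "continuous_on {0..} (\<lambda>t. cpx_op (S t) w)" for w
      by (cases w) (auto simp: cpx_op_def intro!: continuous_on_Pair C0_semigroupD(4)[OF S])
  qed
  moreover have "cpx_dom domT = {v. \<exists>w. ((\<lambda>h. (cpx_op (S h) v - v) /\<^sub>R h) \<longlongrightarrow> w) (at_right 0)}"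
    by (auto simp: cpx_dom_def * mem)
  moreover have "((\<lambda>h. (cpx_op (S h) v - v) /\<^sub>R h) \<longlongrightarrow> cpx_op T v) (at_right 0)"
    if "v \<in> cpx_dom domT" for v
  proof -
    obtain p q where "v = (p, q)" "p \<in> domT" "q \<in> domT"
      using \<open>v \<in> cpx_dom domT\<close> by (auto simp: cpx_dom_def)
    then show ?thesis
      using *[of p q "cpx_op T v"] generatesD(2)[OF T] by (simp add: cpx_op_def)
  qed
  ultimately show ?thesis unfolding generates_def by blast
qed

section \<open>Twisting by an exponential and the resolvent\<close>

lemma exp_difference_quotient:
  "((\<lambda>h. (exp (- (\<zeta> * complex_of_real h)) - 1) /\<^sub>R h) \<longlongrightarrow> - \<zeta>) (at_right 0)"
proof -
  have "((\<lambda>z. exp (- (\<zeta> * z))) has_field_derivative - \<zeta>) (at 0)"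
    by (auto intro!: derivative_eq_intros)
  then have "((\<lambda>z. (exp (- (\<zeta> * z)) - 1) / z) \<longlongrightarrow> - \<zeta>) (at 0)"
    by (simp add: DERIV_def)
  \<comment> \<open>Restricts the complex derivative at 0 to positive real increments.\<close>
  moreover have "filterlim complex_of_real (at 0) (at_right 0)"
    by (auto simp: filterlim_at eventually_at_right_less eventually_at_filter intro!: tendsto_eq_intros)
  ultimately have "((\<lambda>h. (exp (- (\<zeta> * complex_of_real h)) - 1) / complex_of_real h) \<longlongrightarrow> - \<zeta>)
      (at_right 0)"
    by (rule filterlim_compose)
  then show ?thesis by (simp add: scaleR_conv_of_real divide_inverse mult.commute)
qed

text \<open>The product rule at 0, from e P - w = e (P - w) + (e - 1) w with e the exponential
  factor.\<close>

lemma cscale_difference_quotient: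
  fixes P :: "real \<Rightarrow> 'a::real_inner cpx"
  assumes "((\<lambda>h. (P h - w) /\<^sub>R h) \<longlongrightarrow> z) (at_right 0)"
  shows "((\<lambda>h. (exp (- (\<zeta> * complex_of_real h)) *\<^sub>C P h - w) /\<^sub>R h) \<longlongrightarrow> z - \<zeta> *\<^sub>C w) (at_right 0)"
proof -
  note bil = bounded_bilinear_cscale[where 'a = 'a]
  have "((\<lambda>h. exp (- (\<zeta> * complex_of_real h))) \<longlongrightarrow> exp (- (\<zeta> * complex_of_real 0))) (at_right 0)"
    by (intro tendsto_intros)
  then have "((\<lambda>h. exp (- (\<zeta> * complex_of_real h)) *\<^sub>C ((P h - w) /\<^sub>R h)
      + ((exp (- (\<zeta> * complex_of_real h)) - 1) /\<^sub>R h) *\<^sub>C w) \<longlongrightarrow> 1 *\<^sub>C z + (- \<zeta>) *\<^sub>C w) (at_right 0)"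
    by (intro tendsto_add bounded_bilinear.tendsto[OF bil] assms exp_difference_quotient
        tendsto_const) simp
  moreover have "exp (- (\<zeta> * complex_of_real h)) *\<^sub>C ((P h - w) /\<^sub>R h)
      + ((exp (- (\<zeta> * complex_of_real h)) - 1) /\<^sub>R h) *\<^sub>C w
      = (exp (- (\<zeta> * complex_of_real h)) *\<^sub>C P h - w) /\<^sub>R h" for h
    by (simp add: cscale_def prod_eq_iff algebra_simps)
  moreover have "1 *\<^sub>C z + (- \<zeta>) *\<^sub>C w = z - \<zeta> *\<^sub>C w"
    by (simp add: cscale_def prod_eq_iff algebra_simps)
  ultimately show ?thesis by simp
qed

text \<open>\<open>comm\<close> lets the scalar factors pass through \<open>S t\<close>, which the
  semigroup law requires. The domain does not grow, because twisting back with
  \<open>- \<zeta>\<close> recovers \<open>S\<close>.\<close>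

lemma generates_rescale:
  fixes S :: "real \<Rightarrow> 'a::real_inner cpx \<Rightarrow> 'a cpx"
  assumes T: "generates domT T S"
    and comm: "\<And>t \<xi> w. 0 \<le> t \<Longrightarrow> S t (\<xi> *\<^sub>C w) = \<xi> *\<^sub>C S t w"
  shows "generates domT (\<lambda>w. T w - \<zeta> *\<^sub>C w) (\<lambda>t w. exp (- (\<zeta> * complex_of_real t)) *\<^sub>C S t w)"
proof -
  note S = generatesD(1)[OF T]
  let ?E = "\<lambda>t w. exp (- (\<zeta> * complex_of_real t)) *\<^sub>C S t w"
  have "C0_semigroup ?E"
    unfolding C0_semigroup_def
  proof (intro conjI allI impI)
    show "bounded_linear (?E t)" if "0 \<le> t" for t
      by (rule bounded_linear_compose[OF bounded_linear_cscale C0_semigroupD(1)[OF S that]])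
    show "?E 0 = id" by (auto simp: C0_semigroupD(2)[OF S] cscale_one)
    show "?E (s + t) = ?E s \<circ> ?E t" if "0 \<le> s" "0 \<le> t" for s t
      by (auto simp: C0_semigroupD(3)[OF S that] comm that cscale_cscale algebra_simps
          simp flip: exp_add)
    show "continuous_on {0..} (\<lambda>t. ?E t w)" for w
      by (intro bounded_bilinear.continuous_on[OF bounded_bilinear_cscale] continuous_intros
          C0_semigroupD(4)[OF S])
  qed
  moreover have "((\<lambda>h. (?E h w - w) /\<^sub>R h) \<longlongrightarrow> T w - \<zeta> *\<^sub>C w) (at_right 0)"
    if "w \<in> domT" for w
    by (rule cscale_difference_quotient[OF generatesD(2)[OF T that]])
  moreover have "w \<in> domT" if "((\<lambda>h. (?E h w - w) /\<^sub>R h) \<longlongrightarrow> z) (at_right 0)" for w z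
  proof (rule generatesD(3)[OF T])
    have "exp (- (- \<zeta> * complex_of_real h)) *\<^sub>C ?E h w = S h w" for h
      by (simp add: cscale_cscale cscale_one flip: exp_add)
    with cscale_difference_quotient[OF that, of "- \<zeta>"]
    show "((\<lambda>h. (S h w - w) /\<^sub>R h) \<longlongrightarrow> z - (- \<zeta>) *\<^sub>C w) (at_right 0)" by simp
  qed
  ultimately show ?thesis unfolding generates_def by blast
qed

text \<open>Once \<open>Re \<zeta>\<close> exceeds the growth rate, the orbit integral
  \<open>?R\<close> of the twisted semigroup is a right inverse of \<open>?f\<close>. The trivial
  kernel makes \<open>?f\<close> injective, so \<open>?R\<close> is its inverse.\<close>

lemma laplace_resolvent:
  fixes S :: "real \<Rightarrow> 'a::{real_inner, banach, second_countable_topology} \<Rightarrow> 'a"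
  assumes T: "generates domT T S"
  obtains \<omega> where
    "\<And>\<zeta>. \<omega> < Re \<zeta> \<Longrightarrow> \<zeta> \<in> resolvent_set (cpx_dom domT) (cpx_op T)"
    "\<And>\<zeta> w. \<omega> < Re \<zeta> \<Longrightarrow> laplace_exists (\<lambda>t. cpx_op (S t) w) \<zeta>"
    "\<And>\<zeta> w. \<omega> < Re \<zeta> \<Longrightarrow>
      laplace (\<lambda>t. cpx_op (S t) w) \<zeta> = resolvent (cpx_dom domT) (cpx_op T) \<zeta> w"
proof -
  note Sc = generates_cpx[OF T]
  obtain M \<omega> where "0 < M" "0 \<le> \<omega>"
    and M: "\<And>t w. 0 \<le> t \<Longrightarrow> norm (cpx_op (S t) w) \<le> M * exp (\<omega> * t) * norm w"
    by (rule C0_semigroup_exp_bound[OF generatesD(1)[OF Sc]]) (rule that)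
  have "\<zeta> \<in> resolvent_set (cpx_dom domT) (cpx_op T) \<and>
      (\<forall>w. laplace_exists (\<lambda>t. cpx_op (S t) w) \<zeta> \<and>
        laplace (\<lambda>t. cpx_op (S t) w) \<zeta> = resolvent (cpx_dom domT) (cpx_op T) \<zeta> w)"
    if \<zeta>: "\<omega> < Re \<zeta>" for \<zeta>
  proof -
    let ?G = "\<lambda>w. cpx_op T w - \<zeta> *\<^sub>C w" and ?f = "\<lambda>w. \<zeta> *\<^sub>C w - cpx_op T w"
    let ?E = "\<lambda>t w. exp (- (\<zeta> * complex_of_real t)) *\<^sub>C cpx_op (S t) w"
    let ?R = "\<lambda>w. LINT t:{0..}|lborel. ?E t w"
    have E: "generates (cpx_dom domT) ?G ?E"
      by (rule generates_rescale[OF Sc])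
        (rule cpx_op_cscale[OF C0_semigroupD(1)[OF generatesD(1)[OF T]]])
    have a: "0 < Re \<zeta> - \<omega>" using \<zeta> by simp
    have decay: "norm (?E t w) \<le> M * exp (- ((Re \<zeta> - \<omega>) * t)) * norm w" if "0 \<le> t" for t w
    proof -
      have "norm (?E t w) \<le> exp (- (Re \<zeta> * t)) * (M * exp (\<omega> * t) * norm w)"
        using M[OF that, of w] by (simp add: norm_cscale mult.assoc)
      also have "\<dots> = M * (exp (- (Re \<zeta> * t)) * exp (\<omega> * t)) * norm w"
        by (simp only: mult_ac)
      also have "exp (- (Re \<zeta> * t)) * exp (\<omega> * t) = exp (- ((Re \<zeta> - \<omega>) * t))"
        by (simp add: algebra_simps flip: exp_add)
      finally show ?thesis .
    qed
    note stable = E a decay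
    have R: "?R w \<in> cpx_dom domT" "?f (?R w) = w" for w
      using stable_generator_integral[OF stable, of w] by (auto simp: algebra_simps)
    have inj: "inj_on ?f (cpx_dom domT)"
    proof (rule inj_onI)
      fix v w
      assume v: "v \<in> cpx_dom domT" and w: "w \<in> cpx_dom domT" and "?f v = ?f w"
      then have "?G v = ?G w" by (simp add: algebra_simps)
      \<comment> \<open>The difference is written as a sum with a scaled vector to match the two
        closure properties of a generator's domain.\<close>
      moreover have "v + (- 1) *\<^sub>R w \<in> cpx_dom domT"
          "?G (v + (- 1) *\<^sub>R w) = ?G v + (- 1) *\<^sub>R ?G w"
        using generates_linear(1)[OF E v] generates_linear(2)[OF E w, of "- 1"] by metis+
      ultimately have "v + (- 1) *\<^sub>R w = 0"
        using stable_generator_kernel[OF stable, of "v + (- 1) *\<^sub>R w"] by simp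
      then show "v = w" by simp
    qed
    have surj: "?f ` cpx_dom domT = UNIV"
      using R by (metis (no_types, lifting) UNIV_eq_I imageI)
    have res: "resolvent (cpx_dom domT) (cpx_op T) \<zeta> w = ?R w" for w
      unfolding resolvent_def by (rule inv_into_f_eq[OF inj R])
    then have "resolvent (cpx_dom domT) (cpx_op T) \<zeta> = ?R" by blast
    then have "\<zeta> \<in> resolvent_set (cpx_dom domT) (cpx_op T)"
      using inj surj stable_semigroup_bounded_linear[OF stable]
      by (simp add: resolvent_set_def bij_betw_def)
    then show ?thesis
      using stable_semigroup_integrable[OF stable] res
      by (simp add: laplace_exists_def laplace_def)
  qed
  then show thesis using that by blast
qed

subsection \<open>Laplace transforms\<close>

lemma laplace_add:
  assumes "laplace_exists v \<zeta>" "laplace_exists w \<zeta>"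
  shows "laplace_exists (\<lambda>t. v t + w t) \<zeta>"
    "laplace (\<lambda>t. v t + w t) \<zeta> = laplace v \<zeta> + laplace w \<zeta>"
proof -
  have "\<xi> *\<^sub>C (a + b) = \<xi> *\<^sub>C a + \<xi> *\<^sub>C b" for \<xi> and a b :: "'a cpx"
    by (simp add: cscale_def algebra_simps)
  then show "laplace_exists (\<lambda>t. v t + w t) \<zeta>"
    "laplace (\<lambda>t. v t + w t) \<zeta> = laplace v \<zeta> + laplace w \<zeta>"
    using assms by (simp_all add: laplace_exists_def laplace_def)
qed

lemma laplace_cpx_op:
  assumes T: "bounded_linear T" and v: "laplace_exists v \<zeta>"
  shows "laplace_exists (\<lambda>t. cpx_op T (v t)) \<zeta>"
    "laplace (\<lambda>t. cpx_op T (v t)) \<zeta> = cpx_op T (laplace v \<zeta>)"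
proof -
  note lin = bounded_linear_cpx_op[OF T]
  have "indicator {0..} t *\<^sub>R exp (- (\<zeta> * complex_of_real t)) *\<^sub>C cpx_op T (v t)
      = cpx_op T (indicator {0..} t *\<^sub>R exp (- (\<zeta> * complex_of_real t)) *\<^sub>C v t)" for t :: real
    by (simp add: linear_simps(5)[OF lin] cpx_op_cscale[OF T])
  then show "laplace_exists (\<lambda>t. cpx_op T (v t)) \<zeta>"
    "laplace (\<lambda>t. cpx_op T (v t)) \<zeta> = cpx_op T (laplace v \<zeta>)"
    using integrable_bounded_linear[OF lin] integral_bounded_linear[OF lin] v
    by (simp_all add: laplace_exists_def laplace_def set_integrable_def set_lebesgue_integral_def)
qed

text \<open>The weight \<open>exp (- (\<zeta> * complex_of_real t))\<close> stays within the domain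
  and commutes with the operator, so only the exchange with the integral remains.\<close>

lemma laplace_generator:
  assumes T: "generates domT T S" and dom: "\<And>t. 0 < t \<Longrightarrow> v t \<in> cpx_dom domT"
    and v: "laplace_exists v \<zeta>" "laplace_exists (\<lambda>t. cpx_op T (v t)) \<zeta>"
  shows "laplace v \<zeta> \<in> cpx_dom domT"
    "cpx_op T (laplace v \<zeta>) = laplace (\<lambda>t. cpx_op T (v t)) \<zeta>"
proof -
  note Tc = generates_cpx[OF T]
  \<comment> \<open>The cut-off is at \<open>{0<..}\<close> because \<open>v 0\<close> may lie
    outside the domain; elsewhere the value is 0, so \<open>?u t\<close> is in the domain for every
    real \<open>t\<close>.\<close>
  let ?u = "\<lambda>t. indicator {0<..} t *\<^sub>R exp (- (\<zeta> * complex_of_real t)) *\<^sub>C v t"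
  have dom': "?u t \<in> cpx_dom domT" for t
    using generates_cscale(1)[OF T dom] generates_linear(3)[OF Tc] by (auto simp: indicator_def)
  have u: "cpx_op T (?u t)
      = indicator {0<..} t *\<^sub>R exp (- (\<zeta> * complex_of_real t)) *\<^sub>C cpx_op T (v t)" for t
    using generates_cscale(2)[OF T dom] generates_linear(3)[OF Tc] by (auto simp: indicator_def)
  have int: "integrable lborel ?u" "integrable lborel (\<lambda>t. cpx_op T (?u t))"
    using v unfolding u laplace_exists_def set_Ici_Ioi by (simp_all only: set_integrable_def)
  show "laplace v \<zeta> \<in> cpx_dom domT"
    "cpx_op T (laplace v \<zeta>) = laplace (\<lambda>t. cpx_op T (v t)) \<zeta>"
    using generator_integral[OF Tc int dom'] unfolding u laplace_def set_Ici_Ioi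
    by (simp_all only: set_lebesgue_integral_def)
qed

text \<open>Both claims rest on decay of the weighted function at rate
  \<open>Re \<zeta> - \<omega>\<close>; the second disposes of the boundary term at infinity in the
  integration by parts.\<close>

lemma exp_order_laplace_exists:
  fixes v :: "real \<Rightarrow> 'a::{real_inner, banach, second_countable_topology}"
  assumes cont: "continuous_on {0<..} v" and v: "exp_order v"
  obtains \<omega> where "\<And>\<zeta>. \<omega> < Re \<zeta> \<Longrightarrow> laplace_exists (\<lambda>t. cpx (v t)) \<zeta>"
    "\<And>\<zeta>. \<omega> < Re \<zeta> \<Longrightarrow> ((\<lambda>t. exp (- (\<zeta> * complex_of_real t)) *\<^sub>C cpx (v t)) \<longlongrightarrow> 0) at_top"
proof -
  obtain c \<omega> where c: "\<And>t. 0 < t \<Longrightarrow> norm (v t) \<le> c * exp (\<omega> * t)"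
    using v by (auto simp: exp_order_def)
  have bound: "norm (exp (- (\<zeta> * complex_of_real t)) *\<^sub>C cpx (v t)) \<le> c * exp (- ((Re \<zeta> - \<omega>) * t))"
    if "0 < t" for \<zeta> t
  proof -
    have "norm (exp (- (\<zeta> * complex_of_real t)) *\<^sub>C cpx (v t)) \<le> exp (- (Re \<zeta> * t)) * (c * exp (\<omega> * t))"
      using c[OF that] by (simp add: norm_cscale norm_cpx)
    also have "\<dots> = c * (exp (- (Re \<zeta> * t)) * exp (\<omega> * t))"
      by (simp only: mult_ac)
    also have "exp (- (Re \<zeta> * t)) * exp (\<omega> * t) = exp (- ((Re \<zeta> - \<omega>) * t))"
      by (simp add: algebra_simps flip: exp_add)
    finally show ?thesis .
  qed
  have "laplace_exists (\<lambda>t. cpx (v t)) \<zeta>" if "\<omega> < Re \<zeta>" for \<zeta>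
    unfolding laplace_exists_def
    using that
    by (intro set_integrable_exp_bound[OF _ _ bound] bounded_bilinear.continuous_on[OF bounded_bilinear_cscale]
        bounded_linear.continuous_on[OF bounded_linear_cpx] continuous_intros cont) auto
  moreover have "((\<lambda>t. exp (- (\<zeta> * complex_of_real t)) *\<^sub>C cpx (v t)) \<longlongrightarrow> 0) at_top"
    if "\<omega> < Re \<zeta>" for \<zeta>
  proof (rule tendsto_0_le[where K = c])
    show "((\<lambda>t. exp (- ((Re \<zeta> - \<omega>) * t))) \<longlongrightarrow> 0) at_top"
      using that by (intro exp_decay_tendsto) simp
    show "\<forall>\<^sub>F t in at_top. norm (exp (- (\<zeta> * complex_of_real t)) *\<^sub>C cpx (v t))
        \<le> norm (exp (- ((Re \<zeta> - \<omega>) * t))) * c"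
      using bound by (intro eventually_mono[OF eventually_gt_at_top[of 0]]) (simp add: mult.commute)
  qed
  ultimately show thesis using that by blast
qed

lemma laplace_derivative:
  fixes v :: "real \<Rightarrow> 'a::{real_inner, banach, second_countable_topology}"
  assumes cont: "continuous_on {0..} v" "continuous_on {0<..} v'"
    and deriv: "\<And>t. 0 < t \<Longrightarrow> (v has_vector_derivative v' t) (at t)"
    and ex: "laplace_exists (\<lambda>t. cpx (v t)) \<zeta>" "laplace_exists (\<lambda>t. cpx (v' t)) \<zeta>"
    and lim: "((\<lambda>t. exp (- (\<zeta> * complex_of_real t)) *\<^sub>C cpx (v t)) \<longlongrightarrow> 0) at_top"
  shows "laplace (\<lambda>t. cpx (v' t)) \<zeta> = \<zeta> *\<^sub>C laplace (\<lambda>t. cpx (v t)) \<zeta> - cpx (v 0)"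
proof -
  note bil = bounded_bilinear_cscale[where 'a = 'a]
  note lin = bounded_linear_cscale[where 'a = 'a]
  let ?e = "\<lambda>t. exp (- (\<zeta> * complex_of_real t))"
  let ?v = "\<lambda>t. ?e t *\<^sub>C cpx (v t)" and ?v' = "\<lambda>t. ?e t *\<^sub>C cpx (v' t)"
  have int: "set_integrable lborel {0..} ?v" "set_integrable lborel {0..} ?v'"
    using ex by (simp_all add: laplace_exists_def)
  have int': "set_integrable lborel {0..} (\<lambda>t. \<zeta> *\<^sub>C ?v t)"
      "(LINT t:{0..}|lborel. \<zeta> *\<^sub>C ?v t) = \<zeta> *\<^sub>C (LINT t:{0..}|lborel. ?v t)"
    using integrable_bounded_linear[OF lin int(1)[unfolded set_integrable_def]]
      integral_bounded_linear[OF lin int(1)[unfolded set_integrable_def]]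
    by (simp_all add: set_integrable_def set_lebesgue_integral_def linear_simps(5)[OF lin])
  have cont_e: "continuous_on X ?e" for X by (intro continuous_intros)
  note cont_intros = bounded_bilinear.continuous_on[OF bil] cont_e
    bounded_linear.continuous_on[OF bounded_linear_cpx] bounded_linear.continuous_on[OF lin]
  \<comment> \<open>Integration by parts in one stroke: the integrand is the derivative of
    \<open>?v\<close>, whose limit at infinity is 0.\<close>
  have "(LINT t:{0..}|lborel. ?v' t - \<zeta> *\<^sub>C ?v t) = - ?v 0"
  proof (rule integral_derivative_Ici[OF _ _ _ _ lim])
    show "continuous_on {0..} ?v" by (intro cont_intros cont)
    have "continuous_on {0<..} v" by (rule continuous_on_subset[OF cont(1)]) auto
    then show "continuous_on {0<..} (\<lambda>t. ?v' t - \<zeta> *\<^sub>C ?v t)"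
      by (intro continuous_on_diff cont_intros cont)
    show "(?v has_vector_derivative ?v' t - \<zeta> *\<^sub>C ?v t) (at t)" if "0 < t" for t
    proof -
      have "(?e has_vector_derivative - \<zeta> * ?e t) (at t)"
        by (rule has_vector_derivative_real_field) (auto intro!: derivative_eq_intros)
      from bounded_bilinear.has_vector_derivative[OF bil this
          bounded_linear.has_vector_derivative[OF bounded_linear_cpx deriv[OF that]]]
      show ?thesis
        by (simp add: cscale_def prod_eq_iff algebra_simps)
    qed
    show "set_integrable lborel {0..} (\<lambda>t. ?v' t - \<zeta> *\<^sub>C ?v t)"
      by (intro set_integral_diff int int')
  qed
  then show ?thesis
    using int int' by (simp add: laplace_def cscale_one algebra_simps)
qed

text \<open>Some derivative is continuous by definition, and uniqueness of derivatives identifies it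
  with \<open>v'\<close>.\<close>

lemma C1_differentiable_imp_continuous_derivative:
  assumes "v C1_differentiable_on X" "\<And>t. t \<in> X \<Longrightarrow> (v has_vector_derivative v' t) (at t)"
  shows "continuous_on X v'"
proof -
  obtain d where d: "\<And>t. t \<in> X \<Longrightarrow> (v has_vector_derivative d t) (at t)" "continuous_on X d"
    using assms(1) by (auto simp: C1_differentiable_on_def)
  then show ?thesis
    using vector_derivative_unique_at assms(2) by (metis (no_types, lifting) continuous_on_cong)
qed

text \<open>The form shared by both equations of the system: \<open>w\<close> collects the coupling
  term and the forcing.\<close>

lemma laplace_evolution_equation:
  fixes v w :: "real \<Rightarrow> 'a::{real_inner, banach, second_countable_topology}"
  assumes T: "generates domT T S" and dom: "\<And>t. 0 < t \<Longrightarrow> v t \<in> domT"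
    and cont: "continuous_on {0..} v" "continuous_on {0<..} (\<lambda>t. T (v t) + w t)"
    and deriv: "\<And>t. 0 < t \<Longrightarrow> (v has_vector_derivative T (v t) + w t) (at t)"
    and ex: "laplace_exists (\<lambda>t. cpx (v t)) \<zeta>" "laplace_exists (\<lambda>t. cpx (T (v t))) \<zeta>"
      "laplace_exists (\<lambda>t. cpx (w t)) \<zeta>"
    and lim: "((\<lambda>t. exp (- (\<zeta> * complex_of_real t)) *\<^sub>C cpx (v t)) \<longlongrightarrow> 0) at_top"
  shows "laplace (\<lambda>t. cpx (v t)) \<zeta> \<in> cpx_dom domT"
    "\<zeta> *\<^sub>C laplace (\<lambda>t. cpx (v t)) \<zeta> - cpx_op T (laplace (\<lambda>t. cpx (v t)) \<zeta>)
      = cpx (v 0) + laplace (\<lambda>t. cpx (w t)) \<zeta>"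
proof -
  \<comment> \<open>A real vector has imaginary part 0, so \<open>cpx_op T\<close> meets
    \<open>T 0\<close> and the domain must contain 0.\<close>
  have zero: "0 \<in> domT" "T 0 = 0" using generates_linear(3)[OF T] by auto
  have add: "cpx (T (v t) + w t) = cpx (T (v t)) + cpx (w t)" for t
    by (simp add: cpx_def)
  have ex_T: "laplace_exists (\<lambda>t. cpx_op T (cpx (v t))) \<zeta>"
    using ex(2) by (simp add: cpx_op_cpx[of T, OF zero(2)])
  have dom': "cpx (v t) \<in> cpx_dom domT" if "0 < t" for t
    using dom[OF that] zero(1) by (simp add: cpx_def cpx_dom_def)
  note gen = laplace_generator[OF T dom' ex(1) ex_T]
  show "laplace (\<lambda>t. cpx (v t)) \<zeta> \<in> cpx_dom domT" using gen(1) by simp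
  have "laplace_exists (\<lambda>t. cpx (T (v t) + w t)) \<zeta>"
    unfolding add by (rule laplace_add(1)[OF ex(2,3)])
  from laplace_derivative[OF cont deriv ex(1) this lim]
  have "\<zeta> *\<^sub>C laplace (\<lambda>t. cpx (v t)) \<zeta> - cpx (v 0)
      = laplace (\<lambda>t. cpx (T (v t)) + cpx (w t)) \<zeta>"
    by (simp only: add)
  also have "\<dots> = laplace (\<lambda>t. cpx (T (v t))) \<zeta> + laplace (\<lambda>t. cpx (w t)) \<zeta>"
    by (rule laplace_add(2)[OF ex(2,3)])
  also have "laplace (\<lambda>t. cpx (T (v t))) \<zeta> = cpx_op T (laplace (\<lambda>t. cpx (v t)) \<zeta>)"
    using gen(2) by (simp add: cpx_op_cpx[of T, OF zero(2)])
  finally show "\<zeta> *\<^sub>C laplace (\<lambda>t. cpx (v t)) \<zeta> - cpx_op T (laplace (\<lambda>t. cpx (v t)) \<zeta>)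
      = cpx (v 0) + laplace (\<lambda>t. cpx (w t)) \<zeta>"
    by (simp add: algebra_simps)
qed

section \<open>The coupled system\<close>

lemma laplace_coupling:
  fixes w :: "real \<Rightarrow> 'b::{real_inner, banach, second_countable_topology}"
    and p :: "real \<Rightarrow> 'a::{real_inner, banach, second_countable_topology}"
  assumes T: "bounded_linear T" and ex: "laplace_exists (\<lambda>t. cpx (p t)) \<zeta>"
      "laplace_exists (\<lambda>t. cpx (w t)) \<zeta>"
  shows "laplace_exists (\<lambda>t. cpx (T (p t) + w t)) \<zeta>"
    "laplace (\<lambda>t. cpx (T (p t) + w t)) \<zeta>
      = cpx_op T (laplace (\<lambda>t. cpx (p t)) \<zeta>) + laplace (\<lambda>t. cpx (w t)) \<zeta>"
proof -
  have "cpx (T (p t) + w t) = cpx_op T (cpx (p t)) + cpx (w t)" for t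
    using linear_simps(3)[OF T] by (simp add: cpx_op_def cpx_def)
  then show "laplace_exists (\<lambda>t. cpx (T (p t) + w t)) \<zeta>"
    "laplace (\<lambda>t. cpx (T (p t) + w t)) \<zeta>
      = cpx_op T (laplace (\<lambda>t. cpx (p t)) \<zeta>) + laplace (\<lambda>t. cpx (w t)) \<zeta>"
    using laplace_add[OF laplace_cpx_op(1)[OF T ex(1)] ex(2)] laplace_cpx_op(2)[OF T ex(1)]
    by simp_all
qed

theorem proposition3p1:
  fixes A :: "'r::{real_inner, banach, second_countable_topology} \<Rightarrow> 'r" and domA :: "'r set"
    and D :: "'u::{real_inner, banach, second_countable_topology} \<Rightarrow> 'u" and domD :: "'u set"
    and S\<^sub>A :: "real \<Rightarrow> 'r \<Rightarrow> 'r" and S\<^sub>D :: "real \<Rightarrow> 'u \<Rightarrow> 'u"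
    and B :: "'u \<Rightarrow> 'r" and C :: "'r \<Rightarrow> 'u"
    and f x :: "real \<Rightarrow> 'r" and g y :: "real \<Rightarrow> 'u"
    and x\<^sub>0 :: 'r and y\<^sub>0 :: 'u
    and K :: "real \<Rightarrow> 'r \<Rightarrow> 'r"
  assumes "generates domA A S\<^sub>A" and "generates domD D S\<^sub>D"
    and "bounded_linear B" and "bounded_linear C"
    and "continuous_on {0..} f" and "continuous_on {0..} g"
    and "classical_solution domA A B C domD D f g x\<^sub>0 y\<^sub>0 x y"
    and "exp_order x" and "exp_order y"
    and "exp_order (\<lambda>t. A (x t))" and "exp_order (\<lambda>t. D (y t))"
    and "exp_order f" and "exp_order g"
    and K_def: "K = (\<lambda>t. B \<circ> S\<^sub>D t \<circ> C)"
  shows "\<exists>\<omega>::real. \<forall>\<zeta>. Re \<zeta> > \<omega> \<longrightarrow>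
    (let xh = laplace (\<lambda>t. cpx (x t)) \<zeta>;
         fh = laplace (\<lambda>t. cpx (f t)) \<zeta>;
         gh = laplace (\<lambda>t. cpx (g t)) \<zeta>;
         R = resolvent (cpx_dom domD) (cpx_op D) \<zeta>
     in \<zeta> \<in> resolvent_set (cpx_dom domD) (cpx_op D) \<and>
        laplace_exists (\<lambda>t. cpx (x t)) \<zeta> \<and>
        laplace_exists (\<lambda>t. cpx (f t)) \<zeta> \<and>
        laplace_exists (\<lambda>t. cpx (g t)) \<zeta> \<and>
        xh \<in> cpx_dom domA \<and>
        \<zeta> *\<^sub>C xh - cpx_op A xh - cpx_op B (R (cpx_op C xh)) =
          cpx x\<^sub>0 + fh + cpx_op B (R (cpx y\<^sub>0 + gh)) \<and>
        (\<forall>v. laplace_exists (\<lambda>t. cpx_op (K t) v) \<zeta> \<and>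
             laplace (\<lambda>t. cpx_op (K t) v) \<zeta> = cpx_op B (R (cpx_op C v))))"
proof -
  note T = \<open>generates domA A S\<^sub>A\<close> \<open>generates domD D S\<^sub>D\<close>
  note B = \<open>bounded_linear B\<close> and C = \<open>bounded_linear C\<close>
  have cont: "continuous_on {0..} x" "continuous_on {0..} y"
    and C1: "x C1_differentiable_on {0<..}" "y C1_differentiable_on {0<..}"
    and dom: "\<And>t. 0 < t \<Longrightarrow> x t \<in> domA" "\<And>t. 0 < t \<Longrightarrow> y t \<in> domD"
    and deriv: "\<And>t. 0 < t \<Longrightarrow> (x has_vector_derivative A (x t) + (B (y t) + f t)) (at t)"
      "\<And>t. 0 < t \<Longrightarrow> (y has_vector_derivative D (y t) + (C (x t) + g t)) (at t)"
    and init: "x 0 = x\<^sub>0" "y 0 = y\<^sub>0"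
    using \<open>classical_solution domA A B C domD D f g x\<^sub>0 y\<^sub>0 x y\<close>
    by (simp_all add: classical_solution_def add_ac)
  have cont': "continuous_on {0<..} (\<lambda>t. A (x t) + (B (y t) + f t))"
      "continuous_on {0<..} (\<lambda>t. D (y t) + (C (x t) + g t))"
    using C1 deriv by (auto intro: C1_differentiable_imp_continuous_derivative)
  have cont_pos: "continuous_on {0<..} x" "continuous_on {0<..} y"
      "continuous_on {0<..} f" "continuous_on {0<..} g"
    using cont \<open>continuous_on {0..} f\<close> \<open>continuous_on {0..} g\<close>
    by (auto intro: continuous_on_subset)
  \<comment> \<open>\<open>A\<close> and \<open>D\<close> are unbounded, so continuity of
    \<open>A (x t)\<close> and \<open>D (y t)\<close> is recovered by subtracting the continuous
    terms from the continuous derivatives.\<close>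
  have "continuous_on {0<..} (\<lambda>t. A (x t) + (B (y t) + f t) - (B (y t) + f t))"
      "continuous_on {0<..} (\<lambda>t. D (y t) + (C (x t) + g t) - (C (x t) + g t))"
    by (intro continuous_intros cont' cont_pos bounded_linear.continuous_on[OF B]
        bounded_linear.continuous_on[OF C])+
  then have cont_op: "continuous_on {0<..} (\<lambda>t. A (x t))" "continuous_on {0<..} (\<lambda>t. D (y t))"
    by simp_all
  obtain \<omega>\<^sub>x where x: "\<And>\<zeta>. \<omega>\<^sub>x < Re \<zeta> \<Longrightarrow> laplace_exists (\<lambda>t. cpx (x t)) \<zeta>"
    "\<And>\<zeta>. \<omega>\<^sub>x < Re \<zeta> \<Longrightarrow> ((\<lambda>t. exp (- (\<zeta> * complex_of_real t)) *\<^sub>C cpx (x t)) \<longlongrightarrow> 0) at_top"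
    by (rule exp_order_laplace_exists[OF cont_pos(1) \<open>exp_order x\<close>]) (rule that)
  obtain \<omega>\<^sub>y where y: "\<And>\<zeta>. \<omega>\<^sub>y < Re \<zeta> \<Longrightarrow> laplace_exists (\<lambda>t. cpx (y t)) \<zeta>"
    "\<And>\<zeta>. \<omega>\<^sub>y < Re \<zeta> \<Longrightarrow> ((\<lambda>t. exp (- (\<zeta> * complex_of_real t)) *\<^sub>C cpx (y t)) \<longlongrightarrow> 0) at_top"
    by (rule exp_order_laplace_exists[OF cont_pos(2) \<open>exp_order y\<close>]) (rule that)
  obtain \<omega>\<^sub>A where Ax: "\<And>\<zeta>. \<omega>\<^sub>A < Re \<zeta> \<Longrightarrow> laplace_exists (\<lambda>t. cpx (A (x t))) \<zeta>"
    by (rule exp_order_laplace_exists[OF cont_op(1) \<open>exp_order (\<lambda>t. A (x t))\<close>]) (rule that)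
  obtain \<omega>\<^sub>D where Dy: "\<And>\<zeta>. \<omega>\<^sub>D < Re \<zeta> \<Longrightarrow> laplace_exists (\<lambda>t. cpx (D (y t))) \<zeta>"
    by (rule exp_order_laplace_exists[OF cont_op(2) \<open>exp_order (\<lambda>t. D (y t))\<close>]) (rule that)
  obtain \<omega>\<^sub>f where f: "\<And>\<zeta>. \<omega>\<^sub>f < Re \<zeta> \<Longrightarrow> laplace_exists (\<lambda>t. cpx (f t)) \<zeta>"
    by (rule exp_order_laplace_exists[OF cont_pos(3) \<open>exp_order f\<close>]) (rule that)
  obtain \<omega>\<^sub>g where g: "\<And>\<zeta>. \<omega>\<^sub>g < Re \<zeta> \<Longrightarrow> laplace_exists (\<lambda>t. cpx (g t)) \<zeta>"
    by (rule exp_order_laplace_exists[OF cont_pos(4) \<open>exp_order g\<close>]) (rule that)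
  obtain \<omega>\<^sub>S where R:
    "\<And>\<zeta>. \<omega>\<^sub>S < Re \<zeta> \<Longrightarrow> \<zeta> \<in> resolvent_set (cpx_dom domD) (cpx_op D)"
    "\<And>\<zeta> w. \<omega>\<^sub>S < Re \<zeta> \<Longrightarrow> laplace_exists (\<lambda>t. cpx_op (S\<^sub>D t) w) \<zeta>"
    "\<And>\<zeta> w. \<omega>\<^sub>S < Re \<zeta> \<Longrightarrow>
      laplace (\<lambda>t. cpx_op (S\<^sub>D t) w) \<zeta> = resolvent (cpx_dom domD) (cpx_op D) \<zeta> w"
    by (rule laplace_resolvent[OF T(2)]) (rule that)
  \<comment> \<open>To the right of the largest threshold all transforms exist and the resolvent of
    \<open>D\<close> is available.\<close>
  define \<omega> where "\<omega> = Max {\<omega>\<^sub>x, \<omega>\<^sub>y, \<omega>\<^sub>A, \<omega>\<^sub>D, \<omega>\<^sub>f, \<omega>\<^sub>g, \<omega>\<^sub>S}"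
  show ?thesis
  proof (intro exI[of _ \<omega>] allI impI)
    fix \<zeta>
    assume "\<omega> < Re \<zeta>"
    then have \<zeta>: "\<omega>\<^sub>x < Re \<zeta>" "\<omega>\<^sub>y < Re \<zeta>" "\<omega>\<^sub>A < Re \<zeta>" "\<omega>\<^sub>D < Re \<zeta>" "\<omega>\<^sub>f < Re \<zeta>"
        "\<omega>\<^sub>g < Re \<zeta>" "\<omega>\<^sub>S < Re \<zeta>"
      by (simp_all add: \<omega>_def)
    note x = x[OF \<zeta>(1)] and y = y[OF \<zeta>(2)] and Ax = Ax[OF \<zeta>(3)] and Dy = Dy[OF \<zeta>(4)]
      and f = f[OF \<zeta>(5)] and g = g[OF \<zeta>(6)] and R = R[OF \<zeta>(7)]
    let ?x = "laplace (\<lambda>t. cpx (x t)) \<zeta>" and ?y = "laplace (\<lambda>t. cpx (y t)) \<zeta>"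
      and ?f = "laplace (\<lambda>t. cpx (f t)) \<zeta>" and ?g = "laplace (\<lambda>t. cpx (g t)) \<zeta>"
      and ?R = "resolvent (cpx_dom domD) (cpx_op D) \<zeta>"
    note By = laplace_coupling[OF B y(1) f] and Cx = laplace_coupling[OF C x(1) g]
    note eq_x = laplace_evolution_equation[OF T(1) dom(1) cont(1) cont'(1) deriv(1) x(1) Ax By(1) x(2)]
      and eq_y = laplace_evolution_equation[OF T(2) dom(2) cont(2) cont'(2) deriv(2) y(1) Dy Cx(1) y(2)]
    have inj: "inj_on (\<lambda>w. \<zeta> *\<^sub>C w - cpx_op D w) (cpx_dom domD)" and lin: "bounded_linear ?R"
      using R(1) by (auto simp: resolvent_set_def bij_betw_def)
    \<comment> \<open>The resolvent is a left inverse on the domain only; \<open>eq_y(1)\<close>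
      places the transform of \<open>y\<close> there.\<close>
    have "?y = ?R (\<zeta> *\<^sub>C ?y - cpx_op D ?y)"
      unfolding resolvent_def using inv_into_f_f[OF inj eq_y(1)] by simp
    also have "\<zeta> *\<^sub>C ?y - cpx_op D ?y = cpx_op C ?x + (cpx y\<^sub>0 + ?g)"
      using eq_y(2) Cx(2) init by (simp add: add_ac)
    finally have y_eq: "?y = ?R (cpx_op C ?x) + ?R (cpx y\<^sub>0 + ?g)"
      using linear_simps(1)[OF lin, of "cpx_op C ?x" "cpx y\<^sub>0 + ?g"] by simp
    \<comment> \<open>The transformed first equation; substituting \<open>y_eq\<close> and moving
      the term in \<open>?x\<close> to the left eliminates the transform of
      \<open>y\<close>.\<close>
    have "\<zeta> *\<^sub>C ?x - cpx_op A ?x = cpx x\<^sub>0 + (cpx_op B ?y + ?f)"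
      using eq_x(2) By(2) init by simp
    also have "cpx_op B ?y = cpx_op B (?R (cpx_op C ?x)) + cpx_op B (?R (cpx y\<^sub>0 + ?g))"
      using linear_simps(1)[OF bounded_linear_cpx_op[OF B]] y_eq by metis
    finally have main: "\<zeta> *\<^sub>C ?x - cpx_op A ?x - cpx_op B (?R (cpx_op C ?x))
        = cpx x\<^sub>0 + ?f + cpx_op B (?R (cpx y\<^sub>0 + ?g))"
      by (simp add: algebra_simps)
    \<comment> \<open>Complexification respects composition, so the bounded \<open>B\<close> leaves
      the integral and what remains is the orbit of \<open>S\<^sub>D\<close> through
      \<open>cpx_op C v\<close>, whose transform is the resolvent.\<close>
    have "cpx_op (K t) v = cpx_op B (cpx_op (S\<^sub>D t) (cpx_op C v))" for t v
      by (cases v) (simp add: K_def cpx_op_def)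
    then have kernel: "laplace_exists (\<lambda>t. cpx_op (K t) v) \<zeta>"
        "laplace (\<lambda>t. cpx_op (K t) v) \<zeta> = cpx_op B (?R (cpx_op C v))" for v
      using laplace_cpx_op[OF B R(2)] R(3) by simp_all
    show "let xh = ?x; fh = ?f; gh = ?g; R = ?R
     in \<zeta> \<in> resolvent_set (cpx_dom domD) (cpx_op D) \<and>
        laplace_exists (\<lambda>t. cpx (x t)) \<zeta> \<and>
        laplace_exists (\<lambda>t. cpx (f t)) \<zeta> \<and>
        laplace_exists (\<lambda>t. cpx (g t)) \<zeta> \<and>
        xh \<in> cpx_dom domA \<and>
        \<zeta> *\<^sub>C xh - cpx_op A xh - cpx_op B (R (cpx_op C xh)) =
          cpx x\<^sub>0 + fh + cpx_op B (R (cpx y\<^sub>0 + gh)) \<and>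
        (\<forall>v. laplace_exists (\<lambda>t. cpx_op (K t) v) \<zeta> \<and>
             laplace (\<lambda>t. cpx_op (K t) v) \<zeta> = cpx_op B (R (cpx_op C v)))"
      unfolding Let_def using R(1) x(1) f g eq_x(1) main kernel by blast
  qed
qed

end
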